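(* Let $n,q$ be positive integers with $n$ even, $n\ge4$, $q\ge2$. Any $3$-design $C$ in $H(n,q)$ with degree $2$ and degree set $\{n/2,n\}$ is isomorphic to the Hadamard code of a Hadamard matrix of order $n$.
   Context: $[q]=\{1,\ldots,q\}$; $\partial$ is Hamming distance. A nonempty $C\subseteq[q]^n$ is a $t$-design in the Hamming scheme $H(n,q)$ if the array of its elements (as rows) is an orthogonal array of strength $t$: in any $t$ columns every element of $[q]^t$ occurs equally often. Its degree set is $\{\partial(x,y):x,y\in C,x\ne y\}$ and its degree is the size of that set. For a Hadamard matrix $H$ of order $n$ (an $n\times n$ $\pm1$ matrix with $HH^\top=nI$), its Hadamard code is the set of $2n$ vectors in $\{1,2\}^n$ obtained from the rows of $H$ and of $-H$ by replacing each entry $1$ by $1$ and each entry $-1$ by $2$. Two codes are isomorphic if one is obtained from the other by permuting coordinates and permuting symbols within each coordinate. *)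

theory Defs
  imports "Jordan_Normal_Form.Matrix" "HOL-Combinatorics.Permutations"
begin

text \<open>
  Words of length \<open>n\<close> over \<open>[q] = {1..q}\<close> are vectors of dimension \<open>n\<close>; coordinates are
  indexed by \<open>{..<n}\<close>, as usual for vectors and matrices here.
\<close>

definition hamming_words :: "nat \<Rightarrow> nat \<Rightarrow> nat vec set" where
  "hamming_words n q = {x \<in> carrier_vec n. \<forall>i<n. x $ i \<in> {1..q}}"

definition hamming_dist :: "'a vec \<Rightarrow> 'a vec \<Rightarrow> nat" where
  "hamming_dist x y = card {i. i < dim_vec x \<and> x $ i \<noteq> y $ i}"

definition hamming_design :: "nat \<Rightarrow> nat \<Rightarrow> nat \<Rightarrow> nat vec set \<Rightarrow> bool" where
  "hamming_design t n q C \<longleftrightarrow>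
     C \<noteq> {} \<and> C \<subseteq> hamming_words n q \<and>
     (\<forall>J. J \<subseteq> {..<n} \<and> card J = t \<longrightarrow>
        (\<exists>l. \<forall>w \<in> J \<rightarrow>\<^sub>E {1..q}. card {x \<in> C. \<forall>j\<in>J. x $ j = w j} = l))"

definition degree_set :: "'a vec set \<Rightarrow> nat set" where
  "degree_set C = {hamming_dist x y | x y. x \<in> C \<and> y \<in> C \<and> x \<noteq> y}"

definition code_degree :: "'a vec set \<Rightarrow> nat" where
  "code_degree C = card (degree_set C)"

definition hadamard_matrix :: "nat \<Rightarrow> int mat \<Rightarrow> bool" where
  "hadamard_matrix n H \<longleftrightarrow>
     H \<in> carrier_mat n n \<and>
     (\<forall>i<n. \<forall>j<n. H $$ (i, j) \<in> {1, -1}) \<and>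
     H * transpose_mat H = int n \<cdot>\<^sub>m 1\<^sub>m n"

definition sign_symbol :: "int \<Rightarrow> nat" where
  "sign_symbol a = (if a = 1 then 1 else 2)"

definition hadamard_code :: "int mat \<Rightarrow> nat vec set" where
  "hadamard_code H = map_vec sign_symbol ` (set (rows H) \<union> set (rows (- H)))"

text \<open>
  Isomorphism of codes over \<open>[q]\<close>: one permutation of the coordinates and, for each
  coordinate \<open>i\<close>, a permutation \<open>\<sigma> i\<close> of the whole alphabet \<open>[q]\<close>. A code in \<open>{1,2}^n\<close>
  is regarded as a subset of \<open>[q]^n\<close> when \<open>q \<ge> 2\<close>.
\<close>

definition code_isomorphic :: "nat \<Rightarrow> nat \<Rightarrow> nat vec set \<Rightarrow> nat vec set \<Rightarrow> bool" where
  "code_isomorphic n q C D \<longleftrightarrow>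
     (\<exists>\<pi> \<sigma>. \<pi> permutes {..<n} \<and> (\<forall>i<n. \<sigma> i permutes {1..q}) \<and>
        D = (\<lambda>x. vec n (\<lambda>i. \<sigma> i (x $ \<pi> i))) ` C)"

end

theory Submission imports Defs begin

text \<open>
  Fix a codeword \<open>x\<close> and write \<open>n = 2m\<close>, \<open>N = |C|\<close>. The number of coordinates in which a
  codeword agrees with \<open>x\<close> is \<open>2m\<close> (for \<open>x\<close> itself), \<open>m\<close> or \<open>0\<close>. If \<open>A\<close> codewords have agreement
  \<open>m\<close> with \<open>x\<close>, the first two moments of the agreement, which strength 2 prescribes, give
  \<open>q (A + 2) = 2 N\<close> and \<open>(A + 2) (1 - (q - 2) (m - 1)) = 2 q m\<close>. Positivity of the second left-hand
  side forces \<open>q = 2\<close>, and then \<open>N = 2n\<close> and \<open>A = 2n - 2\<close>, so exactly one codeword, the complement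
  of \<open>x\<close>, is at distance \<open>n\<close>. The \<open>n\<close> codewords with first symbol 1 are pairwise at distance
  \<open>n/2\<close>: they are the rows of a Hadamard matrix, whose code is \<open>C\<close> itself.
\<close>

section \<open>Counting codewords in designs\<close>

lemma finite_hamming_words: "finite (hamming_words n q)"
proof (rule finite_subset)
  show "hamming_words n q \<subseteq> vec n ` ({..<n} \<rightarrow>\<^sub>E {1..q})"
  proof
    fix x assume x: "x \<in> hamming_words n q"
    have "x = vec n (restrict (($) x) {..<n})"
      using x by (auto simp: hamming_words_def)
    moreover have "restrict (($) x) {..<n} \<in> {..<n} \<rightarrow>\<^sub>E {1..q}"
      using x by (auto simp: hamming_words_def)
    ultimately show "x \<in> vec n ` ({..<n} \<rightarrow>\<^sub>E {1..q})" by (rule image_eqI)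
  qed
  show "finite (vec n ` ({..<n} \<rightarrow>\<^sub>E {1..q}))"
    by (intro finite_imageI finite_PiE) auto
qed

lemma hamming_design_finite: "hamming_design t n q C \<Longrightarrow> finite C"
  unfolding hamming_design_def using finite_hamming_words finite_subset by blast

text \<open>Restriction to \<open>J\<close> sorts the codewords into \<open>q ^ t\<close> classes,
  one per pattern on \<open>J\<close>, all of the same size. The multiplied form avoids division in
  the naturals.\<close>

lemma hamming_design_card:
  assumes "hamming_design t n q C" and J: "J \<subseteq> {..<n}" "card J = t"
    and w: "w \<in> J \<rightarrow>\<^sub>E {1..q}"
  shows "q ^ t * card {x \<in> C. \<forall>j\<in>J. x $ j = w j} = card C"
proof -
  have finJ: "finite J" using J finite_subset by blast
  have finC: "finite C" using assms(1) by (rule hamming_design_finite)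
  have "\<exists>l. \<forall>v \<in> J \<rightarrow>\<^sub>E {1..q}. card {x \<in> C. \<forall>j\<in>J. x $ j = v j} = l"
    using assms(1) J unfolding hamming_design_def by (elim conjE allE[of _ J]) simp
  then obtain l where l: "\<And>v. v \<in> J \<rightarrow>\<^sub>E {1..q} \<Longrightarrow> card {x \<in> C. \<forall>j\<in>J. x $ j = v j} = l"
    by blast
  define g :: "nat vec \<Rightarrow> nat \<Rightarrow> nat" where "g x = restrict (($) x) J" for x
  have g: "g ` C \<subseteq> J \<rightarrow>\<^sub>E {1..q}"
  proof
    fix v assume "v \<in> g ` C"
    then obtain x where x: "x \<in> C" "v = g x" by blast
    then have "x \<in> hamming_words n q"
      using assms(1) by (auto simp: hamming_design_def)
    then show "v \<in> J \<rightarrow>\<^sub>E {1..q}"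
      using J(1) unfolding x(2) hamming_words_def g_def by (intro restrict_PiE_iff[THEN iffD2]) auto
  qed
  \<comment> \<open>Outside \<open>J\<close> both functions take the default value
    \<open>undefined\<close>, so equality of functions is agreement on \<open>J\<close>.\<close>
  have fibre: "{x \<in> C. g x = v} = {x \<in> C. \<forall>j\<in>J. x $ j = v j}" if "v \<in> J \<rightarrow>\<^sub>E {1..q}" for v
  proof -
    have "g x = v \<longleftrightarrow> (\<forall>j\<in>J. x $ j = v j)" for x
    proof
      assume "\<forall>j\<in>J. x $ j = v j"
      then show "g x = v"
        using PiE_arb[OF that] by (intro ext) (simp add: g_def restrict_def)
    qed (auto simp: g_def)
    then show ?thesis by simp
  qed
  have "card C = (\<Sum>v \<in> J \<rightarrow>\<^sub>E {1..q}. card {x \<in> C. g x = v})"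
    using sum.group[OF finC _ g, of "\<lambda>_. 1::nat"] finJ by (simp add: finite_PiE)
  also have "\<dots> = (\<Sum>v \<in> J \<rightarrow>\<^sub>E {1..q}. l)"
    using fibre l by (intro sum.cong) simp_all
  also have "\<dots> = q ^ t * l"
    using J(2) finJ by (simp add: card_PiE)
  finally show ?thesis using l[OF w] by simp
qed

text \<open>A pattern on \<open>J\<close> extends to a further column \<open>k\<close> in
  \<open>q\<close> ways, each occurring equally often. Such a \<open>k\<close> exists because
  \<open>t < n\<close>.\<close>

lemma hamming_design_Suc:
  assumes "hamming_design (Suc t) n q C" and "t < n"
  shows "hamming_design t n q C"
  unfolding hamming_design_def
proof (intro conjI allI impI)
  show "C \<noteq> {}" and sub: "C \<subseteq> hamming_words n q"
    using assms(1) by (auto simp: hamming_design_def)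
  have finC: "finite C" using assms(1) by (rule hamming_design_finite)
  fix J assume "J \<subseteq> {..<n} \<and> card J = t"
  then have J: "J \<subseteq> {..<n}" "card J = t" by auto
  then have finJ: "finite J" using finite_subset by blast
  have "\<not> {..<n} \<subseteq> J"
    using J assms(2) card_mono[OF finJ, of "{..<n}"] by auto
  then obtain k where k: "k < n" "k \<notin> J" by auto
  have K: "insert k J \<subseteq> {..<n}" "card (insert k J) = Suc t"
    using J k finJ by auto
  have "\<exists>l. \<forall>v \<in> insert k J \<rightarrow>\<^sub>E {1..q}.
      card {x \<in> C. \<forall>j\<in>insert k J. x $ j = v j} = l"
    using assms(1) K unfolding hamming_design_def by (elim conjE allE[of _ "insert k J"]) simp
  then obtain l where l: "\<And>v. v \<in> insert k J \<rightarrow>\<^sub>E {1..q} \<Longrightarrow>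
      card {x \<in> C. \<forall>j\<in>insert k J. x $ j = v j} = l"
    by blast
  show "\<exists>l. \<forall>w \<in> J \<rightarrow>\<^sub>E {1..q}. card {x \<in> C. \<forall>j\<in>J. x $ j = w j} = l"
  proof (intro exI ballI)
    fix w assume w: "w \<in> J \<rightarrow>\<^sub>E {1..q}"
    let ?S = "{x \<in> C. \<forall>j\<in>J. x $ j = w j}"
    have "(\<lambda>x. x $ k) ` ?S \<subseteq> {1..q}"
      using sub k by (auto simp: hamming_words_def)
    then have "card ?S = (\<Sum>a\<in>{1..q}. card {x \<in> ?S. x $ k = a})"
      using sum.group[of ?S "{1..q}" "\<lambda>x. x $ k" "\<lambda>_. 1::nat"] finC by simp
    also have "\<dots> = (\<Sum>a\<in>{1..q}. l)"
    proof (rule sum.cong[OF refl])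
      fix a assume a: "a \<in> {1..q}"
      have "{x \<in> ?S. x $ k = a} = {x \<in> C. \<forall>j\<in>insert k J. x $ j = (w(k := a)) j}"
        using k by auto
      moreover have "w(k := a) \<in> insert k J \<rightarrow>\<^sub>E {1..q}"
        using PiE_fun_upd[OF a w] by simp
      ultimately show "card {x \<in> ?S. x $ k = a} = l" using l by (simp only:)
    qed
    finally show "card ?S = q * l" by simp
  qed
qed

section \<open>Moments of the agreement with a fixed word\<close>

definition agreement :: "'a vec \<Rightarrow> 'a vec \<Rightarrow> nat" where
  "agreement x y = card {i. i < dim_vec x \<and> x $ i = y $ i}"

lemma agreement_add_hamming_dist: "agreement x y + hamming_dist x y = dim_vec x"
proof -
  have "card ({i. i < dim_vec x \<and> x $ i = y $ i} \<union> {i. i < dim_vec x \<and> x $ i \<noteq> y $ i})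
      = agreement x y + hamming_dist x y"
    unfolding agreement_def hamming_dist_def by (intro card_Un_disjoint) auto
  moreover have "{i. i < dim_vec x \<and> x $ i = y $ i} \<union> {i. i < dim_vec x \<and> x $ i \<noteq> y $ i}
      = {..<dim_vec x}" by auto
  ultimately show ?thesis by simp
qed

lemma agreement_eq_sum:
  "dim_vec x = n \<Longrightarrow> agreement x y = (\<Sum>i<n. if y $ i = x $ i then 1 else 0)"
  unfolding agreement_def
  by (subst sum.If_cases) (auto intro!: arg_cong[where f = card])

text \<open>Double counting of the pairs of a codeword and a coordinate where it agrees with
  \<open>x\<close>: each coordinate accounts for a fraction \<open>1/q\<close> of the code.\<close>

lemma agreement_first_moment:
  assumes d: "hamming_design 1 n q C" and x: "x \<in> hamming_words n q"
  shows "q * (\<Sum>y\<in>C. agreement x y) = n * card C"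
proof -
  have fin: "finite C" using d by (rule hamming_design_finite)
  have dim: "dim_vec x = n" using x by (auto simp: hamming_words_def)
  have "(\<Sum>y\<in>C. agreement x y) = (\<Sum>i<n. \<Sum>y\<in>C. if y $ i = x $ i then 1 else 0)"
    unfolding agreement_eq_sum[OF dim] by (rule sum.swap)
  also have "\<dots> = (\<Sum>i<n. card {y \<in> C. y $ i = x $ i})"
    using fin by (simp add: sum.If_cases Int_def)
  finally have "q * (\<Sum>y\<in>C. agreement x y) = (\<Sum>i<n. q * card {y \<in> C. y $ i = x $ i})"
    by (simp add: sum_distrib_left)
  also have "\<dots> = (\<Sum>i<n. card C)"
  proof (rule sum.cong[OF refl])
    fix i assume i: "i \<in> {..<n}"
    then have "restrict (($) x) {i} \<in> {i} \<rightarrow>\<^sub>E {1..q}"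
      using x by (auto simp: hamming_words_def)
    from hamming_design_card[OF d _ _ this] i
    show "q * card {y \<in> C. y $ i = x $ i} = card C" by simp
  qed
  finally show ?thesis by simp
qed

text \<open>The square counts ordered pairs of coordinates of agreement. Each of the
  \<open>n\<close> diagonal pairs accounts for \<open>1/q\<close> of the code, each of the
  \<open>n * (n - 1)\<close> others for \<open>1/q^2\<close>.\<close>

lemma agreement_second_moment:
  assumes d: "hamming_design 2 n q C" and n: "n \<ge> 2" and x: "x \<in> hamming_words n q"
  shows "q\<^sup>2 * (\<Sum>y\<in>C. (agreement x y)\<^sup>2) = n * (q + (n - 1)) * card C"
proof -
  have fin: "finite C" using d by (rule hamming_design_finite)
  have d1: "hamming_design 1 n q C"
    using hamming_design_Suc[of 1 n q C] d n by (simp add: numeral_2_eq_2)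
  have dim: "dim_vec x = n" using x by (auto simp: hamming_words_def)
  let ?E = "\<lambda>i j. {y \<in> C. y $ i = x $ i \<and> y $ j = x $ j}"
  have "(\<Sum>y\<in>C. (agreement x y)\<^sup>2) =
      (\<Sum>y\<in>C. \<Sum>i<n. \<Sum>j<n. if y $ i = x $ i \<and> y $ j = x $ j then 1 else 0)"
    unfolding agreement_eq_sum[OF dim] power2_eq_square sum_product
    by (intro sum.cong refl) auto
  also have "\<dots> = (\<Sum>i<n. \<Sum>j<n. \<Sum>y\<in>C. if y $ i = x $ i \<and> y $ j = x $ j then 1 else 0)"
    by (subst sum.swap) (intro sum.cong refl sum.swap)
  also have "\<dots> = (\<Sum>i<n. \<Sum>j<n. card (?E i j))"
    using fin by (simp add: sum.If_cases Int_def)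
  finally have "q\<^sup>2 * (\<Sum>y\<in>C. (agreement x y)\<^sup>2) = (\<Sum>i<n. \<Sum>j<n. q\<^sup>2 * card (?E i j))"
    by (simp add: sum_distrib_left)
  also have "\<dots> = (\<Sum>i<n. (q + (n - 1)) * card C)"
  proof (rule sum.cong[OF refl])
    fix i assume i: "i \<in> {..<n}"
    have diag: "q\<^sup>2 * card (?E i i) = q * card C"
    proof -
      have "restrict (($) x) {i} \<in> {i} \<rightarrow>\<^sub>E {1..q}"
        using x i by (auto simp: hamming_words_def)
      from hamming_design_card[OF d1 _ _ this] i show ?thesis
        by (simp add: power2_eq_square)
    qed
    have off: "q\<^sup>2 * card (?E i j) = card C" if "j \<in> {..<n} - {i}" for j
    proof -
      have "restrict (($) x) {i, j} \<in> {i, j} \<rightarrow>\<^sub>E {1..q}"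
        using x i that by (auto simp: hamming_words_def)
      from hamming_design_card[OF d _ _ this] i that show ?thesis by auto
    qed
    have "(\<Sum>j<n. q\<^sup>2 * card (?E i j)) =
        q\<^sup>2 * card (?E i i) + (\<Sum>j\<in>{..<n} - {i}. q\<^sup>2 * card (?E i j))"
      using i by (intro sum.remove) auto
    also have "\<dots> = q * card C + (\<Sum>j\<in>{..<n} - {i}. card C)"
      using diag off by (intro arg_cong2[of _ _ _ _ "(+)"] sum.cong) auto
    also have "\<dots> = (q + (n - 1)) * card C"
      using i by (simp add: algebra_simps)
    finally show "(\<Sum>j<n. q\<^sup>2 * card (?E i j)) = (q + (n - 1)) * card C" .
  qed
  finally show ?thesis by (simp only: sum_constant card_lessThan of_nat_id mult.assoc)
qed

section \<open>The alphabet is binary\<close>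

text \<open>The arithmetic core: \<open>a\<close> stands for the number of codewords with agreement
  \<open>m\<close>, and the two equations are the moments for length \<open>2 * m\<close> and code
  size \<open>N\<close>.\<close>

lemma two_distance_moments_imp_binary:
  fixes q m a N :: nat
  assumes "m \<ge> 2" and "q \<ge> 2"
    and first: "q * (2 * m + a * m) = 2 * m * N"
    and second: "q\<^sup>2 * ((2 * m)\<^sup>2 + a * m\<^sup>2) = 2 * m * (q + (2 * m - 1)) * N"
  shows "q = 2" and "N = 4 * m" and "a + 2 = N"
proof -
  \<comment> \<open>Integers are used because the sign of \<open>1 - (Q - 2) * (M - 1)\<close> is at
    issue.\<close>
  define Q M A K where "Q = int q" "M = int m" "A = int a" "K = int N"
  have pos: "M \<ge> 2" "Q \<ge> 2" "A \<ge> 0"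
    using assms by (auto simp: Q_M_A_K_def)
  have "int (q * (2 * m + a * m)) = int (2 * m * N)" using first by simp
  then have "M * (Q * (A + 2)) = M * (2 * K)"
    by (simp add: Q_M_A_K_def algebra_simps)
  then have f: "Q * (A + 2) = 2 * K" using pos by simp
  have "int (q\<^sup>2 * ((2 * m)\<^sup>2 + a * m\<^sup>2)) = int (2 * m * (q + (2 * m - 1)) * N)"
    using second by simp
  then have "Q\<^sup>2 * ((2 * M)\<^sup>2 + A * M\<^sup>2) = M * (Q + (2 * M - 1)) * (2 * K)"
    using assms(1) by (simp add: Q_M_A_K_def mult.assoc mult.left_commute)
  \<comment> \<open>The first moment eliminates \<open>K\<close>; then \<open>Q * M\<close>
    cancels.\<close>
  then have "(Q * M) * (Q * M * (A + 4)) = (Q * M) * ((Q + (2 * M - 1)) * (A + 2))"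
    unfolding f[symmetric] by (simp add: algebra_simps power2_eq_square)
  then have "Q * M * (A + 4) = (Q + (2 * M - 1)) * (A + 2)" using pos by simp
  then have s: "(A + 2) * (1 - (Q - 2) * (M - 1)) = 2 * (Q * M)"
    by (simp add: algebra_simps)
  moreover have "Q * M > 0" using pos by simp
  ultimately have "(A + 2) * (1 - (Q - 2) * (M - 1)) > 0" by simp
  then have lt: "(Q - 2) * (M - 1) < 1"
    using pos by (simp add: zero_less_mult_iff)
  have Q2: "Q = 2"
  proof (rule ccontr)
    assume "Q \<noteq> 2"
    then have "1 * 1 \<le> (Q - 2) * (M - 1)"
      using pos by (intro mult_mono) auto
    with lt show False by simp
  qed
  show "q = 2" using Q2 by (simp add: Q_M_A_K_def)
  \<comment> \<open>For \<open>Q = 2\<close>, \<open>s\<close> reads \<open>A + 2 = 4 * M\<close>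
    and \<open>f\<close> reads \<open>A + 2 = K\<close>.\<close>
  show "N = 4 * m" "a + 2 = N" using s f Q2 by (auto simp: Q_M_A_K_def)
qed

lemma half_distance_design_binary:
  assumes d: "hamming_design 2 n q C" and n: "even n" "n \<ge> 4" and q: "q \<ge> 2"
    and deg: "degree_set C \<subseteq> {n div 2, n}" and x: "x \<in> C"
  shows "q = 2" and "card C = 2 * n" and "\<exists>y\<in>C. hamming_dist x y = n"
proof -
  obtain m where m: "n = 2 * m" using n by auto
  have d1: "hamming_design 1 n q C"
    using hamming_design_Suc[of 1 n q C] d n by (simp add: numeral_2_eq_2)
  have fin: "finite C" using d by (rule hamming_design_finite)
  have xw: "x \<in> hamming_words n q" using d x by (auto simp: hamming_design_def)
  then have dim: "dim_vec x = n" by (auto simp: hamming_words_def)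
  define P where "P = {y \<in> C. y \<noteq> x \<and> hamming_dist x y = m}"
  define R where "R = {y \<in> C. y \<noteq> x \<and> hamming_dist x y = n}"
  have agrx: "agreement x x = 2 * m" using dim m by (simp add: agreement_def)
  have agrP: "agreement x y = m" if "y \<in> P" for y
    using agreement_add_hamming_dist[of x y] that dim m by (simp add: P_def)
  have agrR: "agreement x y = 0" if "y \<in> R" for y
    using agreement_add_hamming_dist[of x y] that dim m by (simp add: R_def)
  have C: "C = insert x (P \<union> R)"
    using x deg m unfolding P_def R_def degree_set_def by auto
  have finPR: "finite P" "finite R" using fin by (auto simp: P_def R_def)
  have disj: "P \<inter> R = {}" "x \<notin> P \<union> R" using m n by (auto simp: P_def R_def)
  \<comment> \<open>The condition \<open>f 0 = 0\<close> removes \<open>R\<close>. The identity and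
    the square, taken for \<open>f\<close>, give the two moments.\<close>
  have total: "(\<Sum>y\<in>C. f (agreement x y)) = f (2 * m) + card P * f m"
    if "f 0 = 0" for f :: "nat \<Rightarrow> nat"
  proof -
    have "(\<Sum>y\<in>C. f (agreement x y)) =
        f (2 * m) + ((\<Sum>y\<in>P. f (agreement x y)) + (\<Sum>y\<in>R. f (agreement x y)))"
      using finPR disj agrx by (subst C) (simp add: sum.union_disjoint)
    then show ?thesis using agrP agrR that by simp
  qed
  have "q * (2 * m + card P * m) = 2 * m * card C"
    using agreement_first_moment[OF d1 xw] total[of "\<lambda>k. k"] m by simp
  moreover have "q\<^sup>2 * ((2 * m)\<^sup>2 + card P * m\<^sup>2) = 2 * m * (q + (2 * m - 1)) * card C"
    using agreement_second_moment[OF d _ xw] total[of "\<lambda>k. k\<^sup>2"] m n by simp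
  moreover have "m \<ge> 2" using m n by simp
  ultimately have bin: "q = 2" "card C = 4 * m" "card P + 2 = card C"
    using two_distance_moments_imp_binary q by blast+
  then show "q = 2" and "card C = 2 * n" using m by auto
  have "card C = Suc (card P + card R)"
    using finPR disj by (subst C) (simp add: card_Un_disjoint)
  \<comment> \<open>Comparison with \<open>card P + 2 = card C\<close> gives
    \<open>card R = 1\<close>.\<close>
  then have "R \<noteq> {}" using bin by auto
  then show "\<exists>y\<in>C. hamming_dist x y = n" by (auto simp: R_def)
qed

section \<open>From a binary code to a Hadamard matrix\<close>

lemma hamming_dist_eq_dim_iff:
  "hamming_dist x y = dim_vec x \<longleftrightarrow> (\<forall>i<dim_vec x. x $ i \<noteq> y $ i)"
proof -
  have "hamming_dist x y = dim_vec x \<longleftrightarrow> agreement x y = 0"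
    using agreement_add_hamming_dist[of x y] by linarith
  also have "\<dots> \<longleftrightarrow> (\<forall>i<dim_vec x. x $ i \<noteq> y $ i)"
    unfolding agreement_def by auto
  finally show ?thesis .
qed

text \<open>Inverse of \<open>sign_symbol\<close> between the symbols 1, 2 and the signs.\<close>

definition symbol_sign :: "nat \<Rightarrow> int" where
  "symbol_sign s = (if s = 1 then 1 else -1)"

lemma sign_symbol_symbol_sign: "s \<in> {1..2} \<Longrightarrow> sign_symbol (symbol_sign s) = s"
  by (auto simp: sign_symbol_def symbol_sign_def)

text \<open>This is why the rows of \<open>- H\<close> yield the complements of the words from
  \<open>H\<close>.\<close>

lemma sign_symbol_uminus_symbol_sign: "s \<in> {1..2} \<Longrightarrow> sign_symbol (- symbol_sign s) = 3 - s"
  by (auto simp: sign_symbol_def symbol_sign_def)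

text \<open>An agreement contributes 1 and a disagreement -1 to the inner product, so distance
  \<open>n/2\<close> means orthogonality.\<close>

lemma sum_symbol_sign_mult:
  assumes "x \<in> hamming_words n 2" "y \<in> hamming_words n 2"
  shows "(\<Sum>i<n. symbol_sign (x $ i) * symbol_sign (y $ i)) = int n - 2 * int (hamming_dist x y)"
proof -
  have dim: "dim_vec x = n" using assms by (auto simp: hamming_words_def)
  have "symbol_sign (x $ i) * symbol_sign (y $ i) =
      2 * (if y $ i = x $ i then 1 else 0) - 1" if "i < n" for i
  proof -
    have "x $ i \<in> {1..2}" "y $ i \<in> {1..2}"
      using assms that by (auto simp: hamming_words_def)
    then have "x $ i = 1 \<or> x $ i = 2" "y $ i = 1 \<or> y $ i = 2" by auto
    then show ?thesis by (auto simp: symbol_sign_def)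
  qed
  then have "(\<Sum>i<n. symbol_sign (x $ i) * symbol_sign (y $ i)) =
      (\<Sum>i<n. 2 * (if y $ i = x $ i then 1 else 0) - 1)"
    by simp
  also have "\<dots> = 2 * (\<Sum>i<n. if y $ i = x $ i then 1 else 0) - int n"
    by (simp add: sum_subtractf sum_distrib_left)
  also have "(\<Sum>i<n. if y $ i = x $ i then 1 else (0::int)) = int (agreement x y)"
    unfolding agreement_eq_sum[OF dim] by (simp add: if_distrib cong: if_cong)
  finally show ?thesis
    using agreement_add_hamming_dist[of x y] dim by linarith
qed

lemma code_isomorphic_refl:
  assumes "C \<subseteq> carrier_vec n"
  shows "code_isomorphic n q C C"
proof -
  have "(\<lambda>x. vec n (\<lambda>i. id (x $ id i))) ` C = (\<lambda>x. x) ` C"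
    using assms by (intro image_cong refl eq_vecI) auto
  then show ?thesis
    unfolding code_isomorphic_def
    by (intro exI[of _ id] exI[of _ "\<lambda>_. id"]) auto
qed

text \<open>The code is closed under complementation, and each complementary pair has exactly one
  word with symbol 1 at coordinate 0. These representatives are the rows sought.\<close>

lemma binary_half_distance_code_hadamard:
  assumes n: "even n" "n > 0" and sub: "C \<subseteq> hamming_words n 2"
    and deg: "degree_set C \<subseteq> {n div 2, n}" and card: "card C = 2 * n"
    and anti: "\<And>x. x \<in> C \<Longrightarrow> \<exists>y\<in>C. hamming_dist x y = n"
  shows "\<exists>H. hadamard_matrix n H \<and> hadamard_code H = C"
proof -
  define cmp where "cmp x = vec n (\<lambda>i. 3 - x $ i)" for x :: "nat vec"
  have fin: "finite C" using sub finite_hamming_words finite_subset by blast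
  have dim: "dim_vec x = n" if "x \<in> C" for x
    using sub that by (auto simp: hamming_words_def)
  have ent: "x $ i \<in> {1..2}" if "x \<in> C" "i < n" for x i
    using sub that by (auto simp: hamming_words_def)
  have ent': "x $ i = 1 \<or> x $ i = 2" if "x \<in> C" "i < n" for x i
    using ent[OF that] by auto
  have cmpC: "cmp x \<in> C" if x: "x \<in> C" for x
  proof -
    obtain y where y: "y \<in> C" "hamming_dist x y = n" using anti x by blast
    then have "x $ i \<noteq> y $ i" if "i < n" for i
      using hamming_dist_eq_dim_iff[of x y] dim[OF x] that by auto
    then have "y $ i = 3 - x $ i" if "i < n" for i
      using ent'[OF x that] ent'[OF y(1) that] that by force
    then have "y = cmp x" using dim[OF y(1)] by (auto simp: cmp_def)
    then show ?thesis using y by simp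
  qed
  have cmp2: "cmp (cmp x) = x" if "x \<in> C" for x
  proof (rule eq_vecI)
    show "cmp (cmp x) $ i = x $ i" if "i < dim_vec x" for i
      using ent'[OF \<open>x \<in> C\<close>, of i] dim[OF \<open>x \<in> C\<close>] that by (auto simp: cmp_def)
  qed (use dim[OF that] in \<open>simp add: cmp_def\<close>)
  define D where "D = {x \<in> C. x $ 0 = 1}"
  have finD: "finite D" using fin by (simp add: D_def)
  have CD: "C = D \<union> cmp ` D"
  proof (intro equalityI subsetI)
    fix x assume x: "x \<in> C"
    show "x \<in> D \<union> cmp ` D"
    proof (cases "x $ 0 = 1")
      case False
      then have "cmp x $ 0 = 1" using ent'[OF x n(2)] n by (simp add: cmp_def)
      then have "cmp x \<in> D" using cmpC[OF x] by (simp add: D_def)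
      then show ?thesis using cmp2[OF x] by (metis UnI2 image_eqI)
    qed (use x in \<open>simp add: D_def\<close>)
  qed (use cmpC in \<open>auto simp: D_def\<close>)
  have "inj_on cmp D" using cmp2 by (intro inj_on_inverseI[of D cmp]) (auto simp: D_def)
  then have "card (cmp ` D) = card D" by (rule card_image)
  moreover have "D \<inter> cmp ` D = {}" using n by (auto simp: D_def cmp_def)
  ultimately have "card C = card D + card D"
    using finD by (subst CD) (simp add: card_Un_disjoint)
  then have cardD: "card D = n" using card by simp
  then obtain f where f: "bij_betw f {..<n} D"
    using ex_bij_betw_nat_finite[OF finD] by (auto simp: lessThan_atLeast0)
  have fD: "f i \<in> D" if "i < n" for i using f that by (auto simp: bij_betw_def)
  then have fC: "f i \<in> C" if "i < n" for i using that by (auto simp: D_def)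
  define H where "H = mat n n (\<lambda>(i, j). symbol_sign (f i $ j))"
  have dist: "hamming_dist (f i) (f k) = n div 2" if "i < n" "k < n" "i \<noteq> k" for i k
  proof -
    have "f i \<noteq> f k" using f that by (auto simp: bij_betw_def inj_on_def)
    then have "hamming_dist (f i) (f k) \<in> {n div 2, n}"
      using deg fC that unfolding degree_set_def by blast
    \<comment> \<open>Sharing the symbol at coordinate 0 rules out distance
      \<open>n\<close>.\<close>
    moreover have "f i $ 0 = f k $ 0" using fD that by (simp add: D_def)
    then have "hamming_dist (f i) (f k) \<noteq> n"
      using hamming_dist_eq_dim_iff[of "f i" "f k"] dim[OF fC[OF that(1)]] n by auto
    ultimately show ?thesis by auto
  qed
  have "hadamard_matrix n H"
    unfolding hadamard_matrix_def
  proof (intro conjI)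
    show "H \<in> carrier_mat n n" by (simp add: H_def)
    show "\<forall>i<n. \<forall>j<n. H $$ (i, j) \<in> {1, - 1}" by (auto simp: H_def symbol_sign_def)
    show "H * transpose_mat H = int n \<cdot>\<^sub>m 1\<^sub>m n"
    proof (rule eq_matI)
      fix i k assume "i < dim_row (int n \<cdot>\<^sub>m 1\<^sub>m n)" "k < dim_col (int n \<cdot>\<^sub>m 1\<^sub>m n)"
      then have ik: "i < n" "k < n" by auto
      have "(H * transpose_mat H) $$ (i, k) =
          (\<Sum>j<n. symbol_sign (f i $ j) * symbol_sign (f k $ j))"
        using ik by (simp add: H_def scalar_prod_def lessThan_atLeast0)
      also have "\<dots> = int n - 2 * int (hamming_dist (f i) (f k))"
        using sub fC ik by (intro sum_symbol_sign_mult) auto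
      \<comment> \<open>Distance 0 on the diagonal gives \<open>n\<close>; off it,
        \<open>n - 2 * (n div 2) = 0\<close> since \<open>n\<close> is even.\<close>
      also have "\<dots> = (int n \<cdot>\<^sub>m 1\<^sub>m n) $$ (i, k)"
        using ik dist[of i k] n(1) by (cases "i = k") (auto simp: hamming_dist_def)
      finally show "(H * transpose_mat H) $$ (i, k) = (int n \<cdot>\<^sub>m 1\<^sub>m n) $$ (i, k)" .
    qed (simp_all add: H_def)
  qed
  moreover have "hadamard_code H = C"
  proof -
    have "set (rows H) = row H ` {..<n}" "set (rows (- H)) = row (- H) ` {..<n}"
      by (auto simp: rows_def H_def)
    then have "hadamard_code H =
        (\<lambda>i. map_vec sign_symbol (row H i)) ` {..<n} \<union>
        (\<lambda>i. map_vec sign_symbol (row (- H) i)) ` {..<n}"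
      by (simp add: hadamard_code_def image_Un image_image)
    also have "(\<lambda>i. map_vec sign_symbol (row H i)) ` {..<n} = f ` {..<n}"
    proof (rule image_cong[OF refl])
      fix i assume "i \<in> {..<n}"
      then show "map_vec sign_symbol (row H i) = f i"
        using dim[OF fC] ent[OF fC]
        by (intro eq_vecI) (auto simp: H_def sign_symbol_symbol_sign)
    qed
    also have "(\<lambda>i. map_vec sign_symbol (row (- H) i)) ` {..<n} = (\<lambda>i. cmp (f i)) ` {..<n}"
    proof (rule image_cong[OF refl])
      fix i assume "i \<in> {..<n}"
      then show "map_vec sign_symbol (row (- H) i) = cmp (f i)"
        using dim[OF fC] ent[OF fC]
        by (intro eq_vecI) (auto simp: H_def cmp_def sign_symbol_uminus_symbol_sign)
    qed
    also have "f ` {..<n} \<union> (\<lambda>i. cmp (f i)) ` {..<n} = D \<union> cmp ` D"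
      using f by (auto simp: bij_betw_def)
    finally show ?thesis using CD by simp
  qed
  ultimately show ?thesis by blast
qed

theorem theorem4p11:
  fixes n q :: nat and C :: "nat vec set"
  assumes "even n" and "n \<ge> 4" and "q \<ge> 2"
    and "hamming_design 3 n q C"
    and "code_degree C = 2"
    and "degree_set C = {n div 2, n}"
  shows "\<exists>H. hadamard_matrix n H \<and> code_isomorphic n q C (hadamard_code H)"
proof -
  have d: "hamming_design 2 n q C"
    using hamming_design_Suc[of 2 n q C] assms by (simp add: eval_nat_numeral)
  have deg: "degree_set C \<subseteq> {n div 2, n}" using assms by simp
  \<comment> \<open>The codeword stays schematic: one instance fixes \<open>q\<close> and the size,
    but a word at distance \<open>n\<close> is needed for every codeword.\<close>
  note binary = half_distance_design_binary[OF d assms(1,2,3) deg]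
  obtain x where "x \<in> C" using d by (auto simp: hamming_design_def)
  then have q: "q = 2" and card: "card C = 2 * n" using binary by blast+
  have sub: "C \<subseteq> hamming_words n 2" using d q by (simp add: hamming_design_def)
  obtain H where "hadamard_matrix n H" "hadamard_code H = C"
    using binary_half_distance_code_hadamard[OF assms(1) _ sub deg card] binary(3) assms(2)
    by auto
  moreover have "code_isomorphic n q C C"
    using sub by (intro code_isomorphic_refl) (auto simp: hamming_words_def)
  ultimately show ?thesis by auto
qed

end
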